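(* For $n\in\mathbb{N}$, let $T_n$ be the graph on vertices $\{x_1,x_2,x_3,y_1,\dots,y_n\}$ whose edges are the three edges $\{x_1,x_2\},\{x_2,x_3\},\{x_1,x_3\}$, the edges $\{y_i,y_{i+1}\}$ for $1\le i\le n-1$, and the edge $\{x_3,y_1\}$. Let $P_i$ denote the path of length $i$ (that is, with $i$ edges and $i+1$ vertices). Then for all $n\geq 5$, $$\operatorname{sdefect}(J(T_n),2)=\operatorname{sdefect}(J(T_{n-1}),2)+\mu\left(J(P_{n-4})^2\right).$$
   Context: Let $\mathbb{K}$ be a field. For a finite simple graph $G$ with edge set $E$, its cover ideal is $J(G)=\bigcap_{\{u,v\}\in E}(u,v)$, an ideal of the polynomial ring over $\mathbb{K}$ whose variables are the vertices of $G$. Its $m$-th symbolic power is $J(G)^{(m)}=\bigcap_{\{u,v\}\in E}(u,v)^m$. For an ideal $I$, $\operatorname{sdefect}(I,m)=\mu\left(I^{(m)}/I^m\right)$, where $\mu$ denotes the minimal number of generators (of a module or ideal). *)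

theory Defs
  imports "HOL-Algebra.Ideal_Product" "HOL-Algebra.Module" "HOL-Library.Poly_Mapping"
begin

section \<open>Graphs\<close>

record 'v ugraph =
  verts :: "'v set"
  edges :: "'v set set"

definition simple_graph :: "'v ugraph \<Rightarrow> bool" where
  "simple_graph G \<longleftrightarrow> finite (verts G) \<and> (\<forall>e\<in>edges G. e \<subseteq> verts G \<and> card e = 2)"

datatype tvertex = X1 | X2 | X3 | Y nat

text \<open>The edge \<open>{X3, Y 1}\<close> is an edge on the given vertex set only for \<open>n \<ge> 1\<close>.\<close>

definition T_graph :: "nat \<Rightarrow> tvertex ugraph" where
  "T_graph n =
     \<lparr> verts = {X1, X2, X3} \<union> Y ` {1..n},
       edges = {{X1, X2}, {X2, X3}, {X1, X3}}
               \<union> {{Y i, Y (i + 1)} | i. 1 \<le> i \<and> i + 1 \<le> n}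
               \<union> {{X3, Y 1}} \<rparr>"

text \<open>The index of a path is its number of edges; it has one more vertex.\<close>

definition path_graph :: "nat \<Rightarrow> nat ugraph" where
  "path_graph l = \<lparr> verts = {0..l}, edges = {{j, j + 1} | j. j < l} \<rparr>"

lemma simple_graph_T_graph: "n \<ge> 1 \<Longrightarrow> simple_graph (T_graph n)"
  unfolding simple_graph_def T_graph_def by (auto simp: card_insert_if)

lemma simple_graph_path_graph: "simple_graph (path_graph l)"
  unfolding simple_graph_def path_graph_def by (auto simp: card_insert_if)


section \<open>Polynomial rings\<close>

text \<open>
  Finitely supported functions from exponent vectors to coefficients. The ring over the
  field \<open>'k\<close> whose variables are exactly the elements of \<open>V\<close> consists of those
  polynomials in which every occurring monomial only involves variables from \<open>V\<close>.
\<close>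

type_synonym ('v, 'k) mpoly = "('v \<Rightarrow>\<^sub>0 nat) \<Rightarrow>\<^sub>0 'k"

definition poly_ring :: "'k::field itself \<Rightarrow> 'v set \<Rightarrow> ('v, 'k) mpoly ring" where
  "poly_ring K V =
     \<lparr> carrier = {p. \<forall>m\<in>Poly_Mapping.keys p. Poly_Mapping.keys m \<subseteq> V},
       mult = (*), one = 1, zero = 0, add = (+) \<rparr>"

definition var :: "'v \<Rightarrow> ('v, 'k::field) mpoly" where
  "var v = Poly_Mapping.single (Poly_Mapping.single v 1) 1"

lemma cring_poly_ring: "cring (poly_ring K V)"
proof (rule cringI)
  show "abelian_group (poly_ring K V)"
  proof (rule abelian_groupI)
    fix p q assume "p \<in> carrier (poly_ring K V)" "q \<in> carrier (poly_ring K V)"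
    then show "p \<oplus>\<^bsub>poly_ring K V\<^esub> q \<in> carrier (poly_ring K V)"
      using Poly_Mapping.keys_add[of p q] by (auto simp: poly_ring_def)
  next
    fix p assume "p \<in> carrier (poly_ring K V)"
    then show "\<exists>q\<in>carrier (poly_ring K V). q \<oplus>\<^bsub>poly_ring K V\<^esub> p = \<zero>\<^bsub>poly_ring K V\<^esub>"
      by (intro bexI[of _ "- p"]) (auto simp: poly_ring_def)
  qed (auto simp: poly_ring_def add_ac)
  show "comm_monoid (poly_ring K V)"
  proof (rule comm_monoidI)
    fix p q assume p: "p \<in> carrier (poly_ring K V)" and q: "q \<in> carrier (poly_ring K V)"
    have "Poly_Mapping.keys m \<subseteq> V" if "m \<in> Poly_Mapping.keys (p * q)" for m
    proof -
      from that Poly_Mapping.keys_mult[of p q] obtain a b where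
        "m = a + b" "a \<in> Poly_Mapping.keys p" "b \<in> Poly_Mapping.keys q" by blast
      then show ?thesis
        using Poly_Mapping.keys_add[of a b] p q by (auto simp: poly_ring_def)
    qed
    then show "p \<otimes>\<^bsub>poly_ring K V\<^esub> q \<in> carrier (poly_ring K V)"
      by (simp add: poly_ring_def)
  qed (auto simp: poly_ring_def mult_ac)
qed (auto simp: poly_ring_def distrib_right)


section \<open>Minimal number of generators\<close>

definition module_span :: "('a, 'c) ring_scheme \<Rightarrow> ('a, 'b, 'd) module_scheme \<Rightarrow> 'b set \<Rightarrow> 'b set" where
  "module_span R M S = \<Inter>{N. submodule N R M \<and> S \<subseteq> N}"

text \<open>
  Only meaningful for finitely generated modules. Below it is only used for subquotients
  of a polynomial ring in finitely many variables over a field, which are Noetherian.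
\<close>

definition min_gens :: "('a, 'c) ring_scheme \<Rightarrow> ('a, 'b, 'd) module_scheme \<Rightarrow> nat" where
  "min_gens R M =
     (LEAST k. \<exists>S. S \<subseteq> carrier M \<and> finite S \<and> card S = k \<and> module_span R M S = carrier M)"

definition ideal_module :: "('a, 'c) ring_scheme \<Rightarrow> 'a set \<Rightarrow> ('a, 'a) module" where
  "ideal_module R I =
     \<lparr> carrier = I, mult = mult R, one = one R, zero = zero R, add = add R, smult = mult R \<rparr>"

text \<open>
  The library's modules extend the record of rings; the fields \<open>mult\<close> and \<open>one\<close>
  play no role for a module. The scalar product is \<open>a \<odot> (N + x) = N + a \<odot> x\<close>.
\<close>

definition quot_module :: "('a, 'b, 'd) module_scheme \<Rightarrow> 'b set \<Rightarrow> ('a, 'b set) module" where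
  "quot_module M N =
     \<lparr> carrier = a_rcosets\<^bsub>M\<^esub> N, mult = undefined, one = undefined, zero = N, add = set_add M,
       smult = (\<lambda>a X. \<Union>x\<in>X. N +>\<^bsub>M\<^esub> (a \<odot>\<^bsub>M\<^esub> x)) \<rparr>"

lemma module_ideal_module:
  assumes "cring R" "ideal I R"
  shows "module R (ideal_module R I)"
proof -
  interpret cring R by fact
  interpret ideal I R by fact
  show ?thesis
  proof (rule moduleI)
    show "abelian_group (ideal_module R I)"
    proof (rule abelian_groupI)
      fix x assume "x \<in> carrier (ideal_module R I)"
      then show "\<exists>y\<in>carrier (ideal_module R I).
          y \<oplus>\<^bsub>ideal_module R I\<^esub> x = \<zero>\<^bsub>ideal_module R I\<^esub>"
        by (intro bexI[of _ "\<ominus>\<^bsub>R\<^esub> x"]) (auto simp: ideal_module_def Icarr l_neg)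
    qed (auto simp: ideal_module_def Icarr a_ac)
  qed (auto simp: ideal_module_def Icarr is_cring I_l_closed l_distr r_distr m_assoc)
qed

lemma quot_module_smult:
  assumes "module R M" "submodule N R M" "a \<in> carrier R" "x \<in> carrier M"
  shows "a \<odot>\<^bsub>quot_module M N\<^esub> (N +>\<^bsub>M\<^esub> x) = N +>\<^bsub>M\<^esub> (a \<odot>\<^bsub>M\<^esub> x)"
proof -
  interpret module R M by fact
  interpret N: submodule N R M by fact
  interpret NS: abelian_subgroup N M
    by (rule abelian_subgroupI3)
       (simp_all add: additive_subgroup_def N.subgroup_axioms abelian_group_axioms)
  have Nc: "y \<in> carrier M" if "y \<in> N" for y using that N.subset by auto
  have eq: "N +>\<^bsub>M\<^esub> (a \<odot>\<^bsub>M\<^esub> z) = N +>\<^bsub>M\<^esub> (a \<odot>\<^bsub>M\<^esub> x)" if "z \<in> N +>\<^bsub>M\<^esub> x" for z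
  proof -
    from that obtain y where y: "y \<in> N" "z = y \<oplus>\<^bsub>M\<^esub> x" by (auto simp: a_r_coset_def')
    then have "a \<odot>\<^bsub>M\<^esub> z = (a \<odot>\<^bsub>M\<^esub> y) \<oplus>\<^bsub>M\<^esub> (a \<odot>\<^bsub>M\<^esub> x)"
      using assms Nc by (simp add: smult_r_distr)
    then have "a \<odot>\<^bsub>M\<^esub> z \<in> N +>\<^bsub>M\<^esub> (a \<odot>\<^bsub>M\<^esub> x)"
      using N.smult_closed assms(3) y(1) by (auto simp: a_r_coset_def')
    then show ?thesis
      by (rule a_repr_independence[symmetric]) (use assms NS.a_subgroup in simp_all)
  qed
  have "x \<in> N +>\<^bsub>M\<^esub> x" using assms NS.a_rcos_self by blast
  then have "(\<Union>z\<in>N +>\<^bsub>M\<^esub> x. N +>\<^bsub>M\<^esub> (a \<odot>\<^bsub>M\<^esub> z)) = N +>\<^bsub>M\<^esub> (a \<odot>\<^bsub>M\<^esub> x)"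
    using eq by blast
  then show ?thesis by (simp add: quot_module_def)
qed

lemma module_quot_module:
  assumes "module R M" "submodule N R M"
  shows "module R (quot_module M N)"
proof -
  interpret module R M by fact
  interpret N: submodule N R M by fact
  interpret NS: abelian_subgroup N M
    by (rule abelian_subgroupI3)
       (simp_all add: additive_subgroup_def N.subgroup_axioms abelian_group_axioms)
  have carrierE: "\<exists>x\<in>carrier M. X = N +>\<^bsub>M\<^esub> x" if "X \<in> carrier (quot_module M N)" for X
    using that by (auto simp: quot_module_def A_RCOSETS_def')
  have carrierI: "N +>\<^bsub>M\<^esub> x \<in> carrier (quot_module M N)" if "x \<in> carrier M" for x
    using that by (auto simp: quot_module_def A_RCOSETS_def')
  have add: "(N +>\<^bsub>M\<^esub> x) \<oplus>\<^bsub>quot_module M N\<^esub> (N +>\<^bsub>M\<^esub> y) = N +>\<^bsub>M\<^esub> (x \<oplus>\<^bsub>M\<^esub> y)"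
    if "x \<in> carrier M" "y \<in> carrier M" for x y
    using that by (simp add: quot_module_def NS.a_rcos_sum)
  show ?thesis
  proof (rule moduleI)
    show "cring R" by (rule is_cring)
    show "abelian_group (quot_module M N)"
    proof (rule abelian_groupI)
      have zero: "\<zero>\<^bsub>quot_module M N\<^esub> = N +>\<^bsub>M\<^esub> \<zero>\<^bsub>M\<^esub>"
        using NS.a_subset by (simp add: quot_module_def a_coset_add_zero)
      show "\<zero>\<^bsub>quot_module M N\<^esub> \<in> carrier (quot_module M N)"
        by (simp add: zero carrierI)
      fix X assume X: "X \<in> carrier (quot_module M N)"
      show "\<zero>\<^bsub>quot_module M N\<^esub> \<oplus>\<^bsub>quot_module M N\<^esub> X = X"
        using carrierE[OF X] by (auto simp: zero add)
      show "\<exists>Z\<in>carrier (quot_module M N). Z \<oplus>\<^bsub>quot_module M N\<^esub> X = \<zero>\<^bsub>quot_module M N\<^esub>"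
      proof -
        from carrierE[OF X] obtain x where x: "x \<in> carrier M" "X = N +>\<^bsub>M\<^esub> x" by blast
        show ?thesis
          by (rule bexI[of _ "N +>\<^bsub>M\<^esub> (\<ominus>\<^bsub>M\<^esub> x)"])
             (use x in \<open>simp_all add: zero add carrierI M.l_neg\<close>)
      qed
      fix Z assume Z: "Z \<in> carrier (quot_module M N)"
      show "X \<oplus>\<^bsub>quot_module M N\<^esub> Z \<in> carrier (quot_module M N)"
        using carrierE[OF X] carrierE[OF Z] by (auto simp: add carrierI)
      show "X \<oplus>\<^bsub>quot_module M N\<^esub> Z = Z \<oplus>\<^bsub>quot_module M N\<^esub> X"
        using carrierE[OF X] carrierE[OF Z] by (auto simp: add M.a_comm)
      fix W assume W: "W \<in> carrier (quot_module M N)"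
      show "(X \<oplus>\<^bsub>quot_module M N\<^esub> Z) \<oplus>\<^bsub>quot_module M N\<^esub> W =
          X \<oplus>\<^bsub>quot_module M N\<^esub> (Z \<oplus>\<^bsub>quot_module M N\<^esub> W)"
        using carrierE[OF X] carrierE[OF Z] carrierE[OF W] by (auto simp: add M.a_assoc)
    qed
  next
    fix a X assume "a \<in> carrier R" "X \<in> carrier (quot_module M N)"
    then show "a \<odot>\<^bsub>quot_module M N\<^esub> X \<in> carrier (quot_module M N)"
      using carrierE[of X] by (auto simp: carrierI quot_module_smult[OF assms])
  next
    fix a b X assume "a \<in> carrier R" "b \<in> carrier R" "X \<in> carrier (quot_module M N)"
    then show "(a \<oplus>\<^bsub>R\<^esub> b) \<odot>\<^bsub>quot_module M N\<^esub> X =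
        (a \<odot>\<^bsub>quot_module M N\<^esub> X) \<oplus>\<^bsub>quot_module M N\<^esub> (b \<odot>\<^bsub>quot_module M N\<^esub> X)"
      using carrierE[of X] by (auto simp: add quot_module_smult[OF assms] smult_l_distr)
  next
    fix a X Z
    assume "a \<in> carrier R" "X \<in> carrier (quot_module M N)" "Z \<in> carrier (quot_module M N)"
    then show "a \<odot>\<^bsub>quot_module M N\<^esub> (X \<oplus>\<^bsub>quot_module M N\<^esub> Z) =
        (a \<odot>\<^bsub>quot_module M N\<^esub> X) \<oplus>\<^bsub>quot_module M N\<^esub> (a \<odot>\<^bsub>quot_module M N\<^esub> Z)"
      using carrierE[of X] carrierE[of Z]
      by (auto simp: add quot_module_smult[OF assms] smult_r_distr)
  next
    fix a b X assume "a \<in> carrier R" "b \<in> carrier R" "X \<in> carrier (quot_module M N)"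
    then show "(a \<otimes>\<^bsub>R\<^esub> b) \<odot>\<^bsub>quot_module M N\<^esub> X =
        a \<odot>\<^bsub>quot_module M N\<^esub> (b \<odot>\<^bsub>quot_module M N\<^esub> X)"
      using carrierE[of X] by (auto simp: quot_module_smult[OF assms] smult_assoc1)
  next
    fix X assume "X \<in> carrier (quot_module M N)"
    then show "\<one>\<^bsub>R\<^esub> \<odot>\<^bsub>quot_module M N\<^esub> X = X"
      using carrierE[of X] by (auto simp: quot_module_smult[OF assms])
  qed
qed


section \<open>Cover ideals and symbolic defect\<close>

text \<open>
  The whole ring is the value of the intersections below if there are no edges. Powers of
  ideals are taken in the library's semiring \<open>ideals_set R\<close> of ideals of \<open>R\<close>.
\<close>

definition edge_prime :: "'k::field itself \<Rightarrow> 'v ugraph \<Rightarrow> 'v set \<Rightarrow> ('v, 'k) mpoly set" where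
  "edge_prime K G e = Idl\<^bsub>poly_ring K (verts G)\<^esub> (var ` e)"

definition cover_ideal :: "'k::field itself \<Rightarrow> 'v ugraph \<Rightarrow> ('v, 'k) mpoly set" where
  "cover_ideal K G = carrier (poly_ring K (verts G)) \<inter> (\<Inter>e\<in>edges G. edge_prime K G e)"

definition cover_ideal_power ::
    "'k::field itself \<Rightarrow> 'v ugraph \<Rightarrow> nat \<Rightarrow> ('v, 'k) mpoly set" where
  "cover_ideal_power K G m = cover_ideal K G [^]\<^bsub>ideals_set (poly_ring K (verts G))\<^esub> m"

definition cover_ideal_symbolic_power ::
    "'k::field itself \<Rightarrow> 'v ugraph \<Rightarrow> nat \<Rightarrow> ('v, 'k) mpoly set" where
  "cover_ideal_symbolic_power K G m =
     carrier (poly_ring K (verts G)) \<inter>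
     (\<Inter>e\<in>edges G. edge_prime K G e [^]\<^bsub>ideals_set (poly_ring K (verts G))\<^esub> m)"

definition cover_ideal_sdefect :: "'k::field itself \<Rightarrow> 'v ugraph \<Rightarrow> nat \<Rightarrow> nat" where
  "cover_ideal_sdefect K G m =
     (let R = poly_ring K (verts G)
      in min_gens R (quot_module (ideal_module R (cover_ideal_symbolic_power K G m))
                                 (cover_ideal_power K G m)))"

end

theory Submission
  imports "HOL.Vector_Spaces" Defs
begin

text \<open>
  All ideals involved are monomial, so everything can be read off exponent vectors. The
  symbolic square of a cover ideal is spanned by the monomials whose exponent vector is a
  2-cover (its values at the two ends of every edge add up to at least 2), and the ordinary
  square by those whose exponent vector is a sum of two 1-covers. For monomial ideals
  \<open>J \<subseteq> I\<close> the number \<open>\<mu>(I/J)\<close> counts the minimal monomials of \<open>I\<close> that are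
  not in \<open>J\<close> (\<open>min_gens_image_mono_ideal\<close>): reading off their coefficients maps
  \<open>I/J\<close> onto a vector space of that dimension, and the ring acts there through constant
  terms only, so fewer elements cannot generate.

  A 2-cover is a sum of two 1-covers as soon as the vertices where it equals 1 induce a
  properly 2-coloured graph (\<open>cover_decomposition\<close>). On a path this is always the case,
  so the square and the symbolic square of the cover ideal coincide. On a triangle with a tail
  it fails exactly if all three triangle vertices have value 1. Hence the symbolic defect
  counts the minimal 2-covers with this property, and these are determined by their values
  along the tail.

  A 2-cover is minimal if and only if every vertex of positive value lies on an edge whose two
  values add up to exactly 2 (\<open>min_cover_iff\<close>). Along the tail this becomes a condition
  on a sequence of numbers that depends only on its length and on the value \<open>p\<close> in front of
  it (\<open>tight_seqs p n\<close>). The tail is preceded by the value 1 at \<open>X3\<close>. It either starts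
  with 1, and the rest is such a tail of length one less, or it starts with \<open>2, 0, 2\<close>,
  after which the rest is an arbitrary minimal 2-cover of a path
  (\<open>tight_seqs_1_split\<close>). Counting both kinds gives the recursion.
\<close>

abbreviation "keys \<equiv> Poly_Mapping.keys"
abbreviation "lookup \<equiv> Poly_Mapping.lookup"
abbreviation "single \<equiv> Poly_Mapping.single"

section \<open>A lower bound for the number of generators\<close>

text \<open>
  The lower bound behind all generator counts. If \<open>R\<close> acts on the target of \<open>\<phi>\<close>
  through scalars, then the preimage of a subspace is a submodule. So the image of a generating
  set spans the images of all elements, in particular an independent family of size
  \<open>card B\<close>. For a graded module over a polynomial ring one takes for \<open>\<phi>\<close> the
  reduction modulo the products of variables with elements of the module.
\<close>

lemma min_gens_eq_card:
  fixes \<phi> :: "'b \<Rightarrow> 'w::ab_group_add" and scale :: "'k::field \<Rightarrow> 'w \<Rightarrow> 'w"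
  assumes "module R M" and vs: "vector_space scale"
    and add: "\<And>x y. x \<in> carrier M \<Longrightarrow> y \<in> carrier M \<Longrightarrow> \<phi> (x \<oplus>\<^bsub>M\<^esub> y) = \<phi> x + \<phi> y"
    and smult: "\<And>r x. r \<in> carrier R \<Longrightarrow> x \<in> carrier M \<Longrightarrow> \<phi> (r \<odot>\<^bsub>M\<^esub> x) = scale (\<epsilon> r) (\<phi> x)"
    and B: "finite B" "B \<subseteq> carrier M" "module_span R M B = carrier M"
    and inj: "inj_on \<phi> B" and indep: "\<not> Modules.module.dependent scale (\<phi> ` B)"
  shows "min_gens R M = card B"
  unfolding min_gens_def
proof (rule Least_equality)
  show "\<exists>S\<subseteq>carrier M. finite S \<and> card S = card B \<and> module_span R M S = carrier M"
    using B by blast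
next
  interpret M: module R M by fact
  interpret vs: vector_space scale by fact
  fix k assume "\<exists>S\<subseteq>carrier M. finite S \<and> card S = k \<and> module_span R M S = carrier M"
  then obtain S where S: "S \<subseteq> carrier M" "finite S" "card S = k" "module_span R M S = carrier M"
    by blast
  define N where "N = {x \<in> carrier M. \<phi> x \<in> vs.span (\<phi> ` S)}"
  have zero: "\<phi> \<zero>\<^bsub>M\<^esub> = 0" using add[of "\<zero>\<^bsub>M\<^esub>" "\<zero>\<^bsub>M\<^esub>"] by simp
  have neg: "\<phi> (\<ominus>\<^bsub>M\<^esub> x) = - \<phi> x" if "x \<in> carrier M" for x
    using add[of "\<ominus>\<^bsub>M\<^esub> x" x] that by (simp add: M.l_neg zero eq_neg_iff_add_eq_0)
  have "submodule N R M"
    by (rule M.submoduleI)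
       (auto simp: N_def zero neg add smult vs.span_zero vs.span_neg vs.span_add vs.span_scale)
  moreover have "S \<subseteq> N" using S(1) by (auto simp: N_def vs.span_base)
  ultimately have "module_span R M S \<subseteq> N" unfolding module_span_def by blast
  then have "\<phi> ` B \<subseteq> vs.span (\<phi> ` S)" using S(4) B(2) by (auto simp: N_def)
  then have "card (\<phi> ` B) \<le> card (\<phi> ` S)"
    using vs.independent_span_bound[OF _ indep] S(2) by blast
  also have "\<dots> \<le> card S" using S(2) by (rule card_image_le)
  finally show "card B \<le> k" using S(3) inj by (simp add: card_image)
qed

section \<open>Monomial ideals\<close>

definition mons :: "'v set \<Rightarrow> ('v \<Rightarrow>\<^sub>0 nat) set" where
  "mons V = {a. keys a \<subseteq> V}"

definition up_closed :: "'v set \<Rightarrow> ('v \<Rightarrow>\<^sub>0 nat) set \<Rightarrow> bool" where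
  "up_closed V E \<longleftrightarrow> E \<subseteq> mons V \<and> (\<forall>a\<in>E. \<forall>c\<in>mons V. a + c \<in> E)"

definition mono_ideal :: "('v \<Rightarrow>\<^sub>0 nat) set \<Rightarrow> ('v, 'k::field) mpoly set" where
  "mono_ideal E = {p. keys p \<subseteq> E}"

definition sumset :: "('v \<Rightarrow>\<^sub>0 nat) set \<Rightarrow> ('v \<Rightarrow>\<^sub>0 nat) set \<Rightarrow> ('v \<Rightarrow>\<^sub>0 nat) set" where
  "sumset E F = {a + b | a b. a \<in> E \<and> b \<in> F}"

text \<open>
  The elements of \<open>E\<close> that are minimal for divisibility of the corresponding monomials.
\<close>

definition min_exps :: "('v \<Rightarrow>\<^sub>0 nat) set \<Rightarrow> ('v \<Rightarrow>\<^sub>0 nat) set" where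
  "min_exps E = {b \<in> E. \<forall>a\<in>E. \<forall>c. b = a + c \<longrightarrow> c = 0}"

lemma add_in_mons_iff: "a + b \<in> mons V \<longleftrightarrow> a \<in> mons V \<and> b \<in> mons V"
proof -
  have "keys (a + b) = keys a \<union> keys b" by (auto simp: in_keys_iff lookup_add)
  then show ?thesis by (auto simp: mons_def)
qed

text \<open>
  Induction along the expansion into terms, all of whose partial sums are supported on
  \<open>E\<close>.
\<close>

lemma mpoly_induct:
  fixes p :: "('v, 'k::field) mpoly"
  assumes "keys p \<subseteq> E" and zero: "P 0" and single: "\<And>m c. m \<in> E \<Longrightarrow> P (single m c)"
    and add: "\<And>p q. keys p \<subseteq> E \<Longrightarrow> keys q \<subseteq> E \<Longrightarrow> P p \<Longrightarrow> P q \<Longrightarrow> P (p + q)"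
  shows "P p"
proof -
  have "S \<subseteq> E \<Longrightarrow> P (\<Sum>m\<in>S. single m (lookup p m)) \<and> keys (\<Sum>m\<in>S. single m (lookup p m)) \<subseteq> E"
    if "finite S" for S
    using that
  proof (induction S)
    case (insert x S)
    have "keys (single x (lookup p x)) \<subseteq> E" using insert.prems by simp
    then show ?case
      using insert Poly_Mapping.keys_add[of "single x (lookup p x)" "\<Sum>m\<in>S. single m (lookup p m)"]
      by (auto intro!: add single)
  qed (simp add: zero)
  moreover have "(\<Sum>m\<in>keys p. single m (lookup p m)) = p"
    by (rule poly_mapping_eqI)
       (auto simp: lookup_sum lookup_single when_def in_keys_iff sum.delta')
  ultimately show ?thesis using assms(1) by (metis finite_keys)
qed

lemma carrier_poly_ring: "carrier (poly_ring K V) = mono_ideal (mons V)"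
  by (auto simp: poly_ring_def mono_ideal_def mons_def)

lemma poly_ring_simps [simp]:
  "mult (poly_ring K V) = (*)" "one (poly_ring K V) = 1"
  "add (poly_ring K V) = (+)" "zero (poly_ring K V) = 0"
  by (simp_all add: poly_ring_def)

lemma a_inv_poly_ring:
  assumes "p \<in> carrier (poly_ring K V)"
  shows "\<ominus>\<^bsub>poly_ring K V\<^esub> p = - p"
proof -
  interpret R: cring "poly_ring K V" by (rule cring_poly_ring)
  have "- p \<in> carrier (poly_ring K V)" using assms by (simp add: poly_ring_def)
  then show ?thesis using R.minus_equality[of "- p" p] assms by simp
qed

lemma mono_ideal_add:
  "p \<in> mono_ideal E \<Longrightarrow> q \<in> mono_ideal E \<Longrightarrow> p + q \<in> mono_ideal E"
  using Poly_Mapping.keys_add[of p q] by (auto simp: mono_ideal_def)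

lemma mono_ideal_mult:
  "p \<in> mono_ideal E \<Longrightarrow> q \<in> mono_ideal F \<Longrightarrow> p * q \<in> mono_ideal (sumset E F)"
  using Poly_Mapping.keys_mult[of p q] by (fastforce simp: mono_ideal_def sumset_def)

lemma single_in_mono_ideal: "m \<in> E \<Longrightarrow> single m c \<in> mono_ideal E"
  by (simp add: mono_ideal_def)

lemma ideal_mono_ideal:
  fixes K :: "'b::field itself" and E :: "('a \<Rightarrow>\<^sub>0 nat) set"
  assumes "up_closed V E"
  shows "ideal (mono_ideal E) (poly_ring K V)"
proof -
  interpret R: cring "poly_ring K V" by (rule cring_poly_ring)
  have carr: "mono_ideal E \<subseteq> carrier (poly_ring K V)"
    using assms by (auto simp: up_closed_def mono_ideal_def carrier_poly_ring)
  have "sumset E (mons V) \<subseteq> E" using assms by (auto simp: up_closed_def sumset_def)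
  then have mult: "p * q \<in> mono_ideal E" if "p \<in> mono_ideal E" "q \<in> mono_ideal (mons V)"
    for p q :: "('a, 'b) mpoly"
    using mono_ideal_mult[OF that] by (auto simp: mono_ideal_def)
  show ?thesis
  proof (rule idealI)
    show "subgroup (mono_ideal E) (add_monoid (poly_ring K V))"
    proof (rule R.add.subgroupI)
      have "0 \<in> mono_ideal E" by (simp add: mono_ideal_def)
      then show "mono_ideal E \<noteq> {}" by blast
    next
      fix p :: "('a, 'b) mpoly" assume "p \<in> mono_ideal E"
      then show "\<ominus>\<^bsub>poly_ring K V\<^esub> p \<in> mono_ideal E"
        using carr by (subst a_inv_poly_ring) (auto simp: mono_ideal_def)
    qed (use carr in \<open>auto intro: mono_ideal_add\<close>)
  qed (use mult in \<open>auto simp: carrier_poly_ring R.ring_axioms mult.commute\<close>)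
qed

text \<open>
  Used for the inclusions of monomial ideals into ideals that are given by generators: it
  suffices to treat single monomials.
\<close>

lemma mono_ideal_subset_ideal:
  assumes "ideal J (poly_ring K V)" "E \<subseteq> mons V" "\<And>m. m \<in> E \<Longrightarrow> single m 1 \<in> J"
  shows "mono_ideal E \<subseteq> J"
proof
  interpret J: ideal J "poly_ring K V" by fact
  fix p :: "('a, 'b) mpoly" assume "p \<in> mono_ideal E"
  then have "keys p \<subseteq> E" by (simp add: mono_ideal_def)
  then show "p \<in> J"
  proof (rule mpoly_induct)
    show "0 \<in> J" using additive_subgroup.zero_closed[OF J.additive_subgroup_axioms] by simp
  next
    fix m c assume "m \<in> E"
    have "single 0 c \<in> carrier (poly_ring K V)" by (simp add: poly_ring_def)
    then have "single 0 c * single m 1 \<in> J"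
      using J.I_l_closed[OF assms(3)[OF \<open>m \<in> E\<close>]] by simp
    then show "single m c \<in> J" by (simp add: mult_single)
  next
    fix p q assume "p \<in> J" "q \<in> J"
    then show "p + q \<in> J"
      using additive_subgroup.a_closed[OF J.additive_subgroup_axioms, of p q] by simp
  qed
qed

lemma up_closed_variables: "up_closed V {a \<in> mons V. \<exists>v\<in>e. v \<in> keys a}"
  by (auto simp: up_closed_def add_in_mons_iff in_keys_iff lookup_add)

lemma genideal_variables:
  assumes "e \<subseteq> V"
  shows "Idl\<^bsub>poly_ring K V\<^esub> (var ` e) = mono_ideal {a \<in> mons V. \<exists>v\<in>e. v \<in> keys a}" (is "_ = mono_ideal ?E")
proof
  interpret R: cring "poly_ring K V" by (rule cring_poly_ring)
  have sub: "var ` e \<subseteq> (mono_ideal ?E :: ('a, 'b) mpoly set)"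
    using assms by (auto simp: var_def mono_ideal_def mons_def)
  have id: "ideal (mono_ideal ?E) (poly_ring K V)"
    by (rule ideal_mono_ideal[OF up_closed_variables])
  then show "Idl\<^bsub>poly_ring K V\<^esub> (var ` e) \<subseteq> mono_ideal ?E"
    using sub by (rule R.genideal_minimal)
  have carr: "var ` e \<subseteq> carrier (poly_ring K V)"
    using sub by (auto simp: mono_ideal_def carrier_poly_ring)
  interpret J: ideal "Idl\<^bsub>poly_ring K V\<^esub> (var ` e)" "poly_ring K V"
    by (rule R.genideal_ideal[OF carr])
  show "mono_ideal ?E \<subseteq> Idl\<^bsub>poly_ring K V\<^esub> (var ` e)"
  proof (rule mono_ideal_subset_ideal[OF J.ideal_axioms])
    fix m assume "m \<in> ?E"
    then obtain v where v: "m \<in> mons V" "v \<in> e" "v \<in> keys m" by blast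
    have m: "m = (m - single v 1) + single v 1"
      using v(3) by (intro poly_mapping_eqI)
        (auto simp: lookup_add lookup_minus lookup_single when_def in_keys_iff)
    then have "m - single v 1 \<in> mons V" using v(1) add_in_mons_iff by metis
    then have "single (m - single v 1) 1 \<in> carrier (poly_ring K V)"
      unfolding carrier_poly_ring by (rule single_in_mono_ideal)
    moreover have "var v \<in> Idl\<^bsub>poly_ring K V\<^esub> (var ` e)"
      using R.genideal_self[OF carr] v(2) by auto
    ultimately have "single (m - single v 1) 1 * var v \<in> Idl\<^bsub>poly_ring K V\<^esub> (var ` e)"
      using J.I_l_closed by fastforce
    then show "single m 1 \<in> Idl\<^bsub>poly_ring K V\<^esub> (var ` e)"
      using m by (simp add: var_def mult_single)
  qed auto
qed

lemma up_closed_sumset: "up_closed V E \<Longrightarrow> up_closed V F \<Longrightarrow> up_closed V (sumset E F)"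
  unfolding up_closed_def sumset_def
  by (auto simp: add_in_mons_iff) (metis add.assoc)

lemma ideal_prod_mono_ideal:
  assumes "up_closed V E" "up_closed V F"
  shows "ideal_prod (poly_ring K V) (mono_ideal E) (mono_ideal F) = mono_ideal (sumset E F)"
proof
  interpret R: cring "poly_ring K V" by (rule cring_poly_ring)
  show "ideal_prod (poly_ring K V) (mono_ideal E) (mono_ideal F) \<subseteq> mono_ideal (sumset E F)"
  proof
    fix s assume "s \<in> ideal_prod (poly_ring K V) (mono_ideal E) (mono_ideal F)"
    then show "s \<in> mono_ideal (sumset E F)"
      by induction (auto intro: mono_ideal_add mono_ideal_mult)
  qed
  show "mono_ideal (sumset E F) \<subseteq> ideal_prod (poly_ring K V) (mono_ideal E) (mono_ideal F)"
  proof (rule mono_ideal_subset_ideal)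
    show "ideal (ideal_prod (poly_ring K V) (mono_ideal E) (mono_ideal F)) (poly_ring K V)"
      by (intro R.ideal_prod_is_ideal ideal_mono_ideal assms)
    show "sumset E F \<subseteq> mons V" using up_closed_sumset[OF assms] by (simp add: up_closed_def)
    fix m assume "m \<in> sumset E F"
    then obtain a b where ab: "a \<in> E" "b \<in> F" "m = a + b" by (auto simp: sumset_def)
    then have "single m 1 = single a 1 \<otimes>\<^bsub>poly_ring K V\<^esub> single b 1" by (simp add: mult_single)
    then show "single m 1 \<in> ideal_prod (poly_ring K V) (mono_ideal E) (mono_ideal F)"
      using ab by (metis ideal_prod.prod single_in_mono_ideal)
  qed
qed

lemma ideal_square:
  assumes "cring R" "ideal I R"
  shows "I [^]\<^bsub>ideals_set R\<^esub> (2::nat) = ideal_prod R I I"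
proof -
  interpret S: semiring "ideals_set R"
    using assms(1) by (rule cring.ideals_set_is_semiring)
  have "I \<in> carrier (ideals_set R)" using assms(2) by (simp add: ideals_set_def)
  then have "I [^]\<^bsub>ideals_set R\<^esub> (2::nat) = I \<otimes>\<^bsub>ideals_set R\<^esub> I"
    by (simp add: numeral_2_eq_2)
  then show ?thesis by (simp add: ideals_set_def)
qed

lemma mono_ideal_square:
  assumes "up_closed V E"
  shows "mono_ideal E [^]\<^bsub>ideals_set (poly_ring K V)\<^esub> (2::nat) = mono_ideal (sumset E E)"
  using ideal_square[OF cring_poly_ring ideal_mono_ideal[OF assms]]
    ideal_prod_mono_ideal[OF assms assms] by metis

section \<open>Minimal monomials as generators\<close>

text \<open>
  Splitting off a nonzero exponent vector lowers the total degree, so the process ends.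
\<close>

lemma min_exps_below:
  assumes "m \<in> E"
  shows "\<exists>b\<in>min_exps E. \<exists>c. m = b + c"
  using assms
proof (induction "\<Sum>v\<in>keys m. lookup m v" arbitrary: m rule: less_induct)
  case less
  show ?case
  proof (cases "m \<in> min_exps E")
    case True
    then show ?thesis by (metis add.right_neutral)
  next
    case False
    then obtain a c where ac: "a \<in> E" "m = a + c" "c \<noteq> 0"
      using less.prems by (auto simp: min_exps_def)
    have "(\<Sum>v\<in>keys m. lookup m v) = (\<Sum>v\<in>keys a. lookup a v) + (\<Sum>v\<in>keys c. lookup c v)"
      unfolding ac(2) by (rule setsum_keys_plus_distrib) auto
    moreover have "keys c \<noteq> {}" using ac(3) by (auto intro!: poly_mapping_eqI simp: in_keys_iff)
    then have "(\<Sum>v\<in>keys c. lookup c v) > 0" by (intro sum_pos) (auto simp: in_keys_iff)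
    ultimately obtain b d where "b \<in> min_exps E" "a = b + d" using less.hyps[of a] ac(1) by auto
    then show ?thesis using ac(2) by (metis add.assoc)
  qed
qed

text \<open>
  A product of monomials with one factor in the ideal can only be a minimal monomial if the other
  factor is 1. This is why the ring acts on the coefficients of minimal monomials through
  constant terms.
\<close>

lemma lookup_mult_min_exp:
  fixes f r :: "('v, 'k::field) mpoly"
  assumes b: "b \<in> min_exps E" and "f \<in> mono_ideal E"
  shows "lookup (r * f) b = lookup r 0 * lookup f b"
proof -
  have "keys f \<subseteq> E" using assms by (simp add: mono_ideal_def)
  then show ?thesis
  proof (rule mpoly_induct)
    fix m c assume m: "m \<in> E"
    have "keys r \<subseteq> UNIV" by simp
    then show "lookup (r * single m c) b = lookup r 0 * lookup (single m c) b"
    proof (rule mpoly_induct)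
      fix m' c'
      have "m' = 0" if "m' + m = b" using that b m by (auto simp: min_exps_def add.commute)
      then show "lookup (single m' c' * single m c) b = lookup (single m' c') 0 * lookup (single m c) b"
        by (auto simp: mult_single lookup_single when_def)
    qed (auto simp: lookup_add ring_distribs)
  qed (auto simp: lookup_add ring_distribs)
qed

text \<open>
  The quotient of two monomial ideals is presented by a surjection \<open>\<pi>\<close> with given kernel,
  so that one statement covers a monomial ideal (\<open>D = {}\<close>) as well as a module of cosets.
  The minimal monomials outside \<open>D\<close> generate, since every monomial of \<open>E\<close> is a
  multiple of a minimal one, and a multiple of one inside \<open>D\<close> is killed by \<open>\<pi>\<close>. Their
  coefficients are well defined on the quotient because the kernel does not involve them.
\<close>

lemma min_gens_image_mono_ideal:
  fixes K :: "'k::field itself" and \<pi> :: "('v, 'k) mpoly \<Rightarrow> 'b"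
  assumes M: "module (poly_ring K V) M"
    and E: "up_closed V E" and D: "up_closed V D"
    and fin: "finite (min_exps E - D)"
    and onto: "\<pi> ` mono_ideal E = carrier M"
    and add: "\<And>f g. f \<in> mono_ideal E \<Longrightarrow> g \<in> mono_ideal E \<Longrightarrow> \<pi> (f + g) = \<pi> f \<oplus>\<^bsub>M\<^esub> \<pi> g"
    and smult: "\<And>r f. r \<in> carrier (poly_ring K V) \<Longrightarrow> f \<in> mono_ideal E \<Longrightarrow>
                  \<pi> (r * f) = r \<odot>\<^bsub>M\<^esub> \<pi> f"
    and kernel: "\<And>f g. f \<in> mono_ideal E \<Longrightarrow> g \<in> mono_ideal E \<Longrightarrow>
                  \<pi> f = \<pi> g \<longleftrightarrow> f - g \<in> mono_ideal D"
  shows "min_gens (poly_ring K V) M = card (min_exps E - D)"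
proof -
  interpret M: module "poly_ring K V" M by fact
  define C where "C = min_exps E - D"
  define B where "B = (\<lambda>b. \<pi> (single b 1)) ` C"
  define proj :: "('v, 'k) mpoly \<Rightarrow> ('v, 'k) mpoly"
    where "proj = Poly_Mapping.mapp (\<lambda>b c. c when b \<in> C)"
  define scale :: "'k \<Rightarrow> ('v, 'k) mpoly \<Rightarrow> ('v, 'k) mpoly" where "scale c p = single 0 c * p" for c p
  \<comment> \<open>Two preimages differ by a polynomial supported on \<open>D\<close>, which is disjoint from \<open>C\<close>.\<close>
  define \<phi> where "\<phi> x = proj (SOME f. f \<in> mono_ideal E \<and> \<pi> f = x)" for x
  have lookup_proj: "lookup (proj f) b = (lookup f b when b \<in> C)" for f b
    by (auto simp: proj_def lookup_mapp when_def in_keys_iff)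
  have C_E: "C \<subseteq> E" by (auto simp: C_def min_exps_def)
  have \<phi>_\<pi>: "\<phi> (\<pi> f) = proj f" if f: "f \<in> mono_ideal E" for f
  proof -
    define g where "g = (SOME g. g \<in> mono_ideal E \<and> \<pi> g = \<pi> f)"
    have "g \<in> mono_ideal E \<and> \<pi> g = \<pi> f"
      using someI[of "\<lambda>g. g \<in> mono_ideal E \<and> \<pi> g = \<pi> f" f] f by (simp add: g_def)
    then have "g - f \<in> mono_ideal D" using kernel[of g f] f by blast
    then have "keys (g - f) \<subseteq> D" by (simp add: mono_ideal_def)
    then have "lookup g b = lookup f b" if "b \<in> C" for b
      using that by (auto simp: C_def in_keys_iff lookup_minus)
    then have "proj g = proj f" by (intro poly_mapping_eqI) (simp add: lookup_proj when_def)
    then show ?thesis by (simp add: \<phi>_def g_def)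
  qed
  have \<phi>_B: "\<phi> (\<pi> (single b 1)) = single b 1" if "b \<in> C" for b
    using that C_E by (subst \<phi>_\<pi>)
      (auto intro!: poly_mapping_eqI single_in_mono_ideal simp: lookup_proj lookup_single when_def)
  have scale: "vector_space scale"
    by unfold_locales
       (simp_all add: scale_def ring_distribs single_add flip: mult.assoc add: mult_single)
  interpret vs: vector_space scale by (rule scale)
  have span: "module_span (poly_ring K V) M B = carrier M"
  proof
    have "B \<subseteq> carrier M" using onto C_E by (auto simp: B_def intro: single_in_mono_ideal)
    then show "module_span (poly_ring K V) M B \<subseteq> carrier M"
      unfolding module_span_def using M.carrier_is_submodule by blast
  next
    have "carrier M \<subseteq> N" if N: "submodule N (poly_ring K V) M" and BN: "B \<subseteq> N" for N
    proof
      interpret N: submodule N "poly_ring K V" M by fact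
      fix x assume "x \<in> carrier M"
      then obtain f where f: "f \<in> mono_ideal E" "x = \<pi> f" using onto by blast
      have zero_E: "0 \<in> mono_ideal E" by (simp add: mono_ideal_def)
      have "\<pi> (0 * 0) = 0 \<odot>\<^bsub>M\<^esub> \<pi> 0" by (rule smult) (simp_all add: zero_E poly_ring_def)
      moreover have "\<pi> 0 \<in> carrier M" using zero_E onto by blast
      ultimately have "\<pi> 0 = \<zero>\<^bsub>M\<^esub>" using M.smult_l_null by simp
      then have zero_N: "\<pi> 0 \<in> N" using N.one_closed by simp
      have "keys f \<subseteq> E" using f by (simp add: mono_ideal_def)
      then have "\<pi> f \<in> N"
      proof (rule mpoly_induct)
        fix m c assume m: "m \<in> E"
        obtain b d where b: "b \<in> min_exps E" "m = b + d" using min_exps_below[OF m] by blast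
        have "m \<in> mons V" using E m by (auto simp: up_closed_def)
        then have d: "d \<in> mons V" using b add_in_mons_iff by blast
        show "\<pi> (single m c) \<in> N"
        proof (cases "b \<in> D")
          case True
          then have "m \<in> D" using D b d by (auto simp: up_closed_def)
          then have "\<pi> (single m c) = \<pi> 0"
            by (subst kernel) (auto simp: zero_E m single_in_mono_ideal)
          then show ?thesis using zero_N by simp
        next
          case False
          then have bC: "b \<in> C" using b by (simp add: C_def)
          have dc: "single d c \<in> carrier (poly_ring K V)"
            unfolding carrier_poly_ring using d by (rule single_in_mono_ideal)
          have "\<pi> (single m c) = \<pi> (single d c * single b 1)"
            by (simp add: mult_single b add.commute)
          also have "\<dots> = single d c \<odot>\<^bsub>M\<^esub> \<pi> (single b 1)"
            using bC C_E by (intro smult dc single_in_mono_ideal) blast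
          finally show ?thesis using N.smult_closed[OF dc] BN bC by (auto simp: B_def)
        qed
      next
        fix p q assume "keys p \<subseteq> E" "keys q \<subseteq> E" "\<pi> p \<in> N" "\<pi> q \<in> N"
        then show "\<pi> (p + q) \<in> N"
          using add[of p q] M.submoduleE(5)[OF N] by (simp add: mono_ideal_def)
      qed (rule zero_N)
      then show "x \<in> N" using f by simp
    qed
    then show "carrier M \<subseteq> module_span (poly_ring K V) M B" by (auto simp: module_span_def)
  qed
  have sum_scale: "lookup (\<Sum>v\<in>(\<lambda>b. single b 1) ` C. scale (u v) v) b = u (single b 1)"
    if "b \<in> C" for u b
  proof -
    have inj: "inj_on (\<lambda>b. single b (1::'k)) C" by (rule inj_onI) (metis lookup_single_eq lookup_single_not_eq zero_neq_one)
    show ?thesis using that fin[folded C_def]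
      by (simp add: sum.reindex[OF inj] lookup_sum scale_def mult_single lookup_single when_def)
  qed
  have "min_gens (poly_ring K V) M = card B"
  proof (rule min_gens_eq_card[where \<phi> = \<phi> and scale = scale and \<epsilon> = "\<lambda>r. lookup r 0"])
    fix x y assume "x \<in> carrier M" "y \<in> carrier M"
    then obtain f g where "f \<in> mono_ideal E" "g \<in> mono_ideal E" "x = \<pi> f" "y = \<pi> g"
      using onto by blast
    then show "\<phi> (x \<oplus>\<^bsub>M\<^esub> y) = \<phi> x + \<phi> y"
      by (simp add: \<phi>_\<pi> mono_ideal_add flip: add)
         (auto intro!: poly_mapping_eqI simp: lookup_proj lookup_add when_def)
  next
    fix r x assume r: "r \<in> carrier (poly_ring K V)" and "x \<in> carrier M"
    then obtain f where f: "f \<in> mono_ideal E" "x = \<pi> f" using onto by blast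
    interpret I: ideal "mono_ideal E" "poly_ring K V" by (rule ideal_mono_ideal[OF E])
    have rf: "r * f \<in> mono_ideal E" using I.I_l_closed[OF f(1) r] by simp
    have "lookup (single 0 (lookup r 0) * proj f) b = lookup r 0 * lookup (proj f) b" for b
      by (simp flip: mult_map_scale_conv_mult add: Poly_Mapping.map.rep_eq when_def)
    then have "proj (r * f) = scale (lookup r 0) (proj f)"
      using f(1) by (intro poly_mapping_eqI)
        (auto simp: scale_def lookup_proj when_def C_def lookup_mult_min_exp)
    then show "\<phi> (r \<odot>\<^bsub>M\<^esub> x) = scale (lookup r 0) (\<phi> x)"
      using f r rf by (simp add: \<phi>_\<pi> flip: smult)
  next
    show "finite B" using fin by (simp add: B_def C_def)
    show "B \<subseteq> carrier M" using onto C_E by (auto simp: B_def intro: single_in_mono_ideal)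
    show "inj_on \<phi> B"
      by (rule inj_onI) (auto simp: B_def \<phi>_B dest!: arg_cong[of "single _ _" _ keys])
    have \<phi>_image: "\<phi> ` B = (\<lambda>b. single b 1) ` C"
      unfolding B_def image_image by (rule image_cong) (simp_all add: \<phi>_B)
    show "vs.independent (\<phi> ` B)"
      unfolding \<phi>_image
    proof (rule vs.independent_if_scalars_zero)
      show "finite ((\<lambda>b. single b (1::'k)) ` C)" using fin by (simp add: C_def)
      fix u v
      assume zero: "(\<Sum>v\<in>(\<lambda>b. single b (1::'k)) ` C. scale (u v) v) = 0"
        and "v \<in> (\<lambda>b. single b (1::'k)) ` C"
      then obtain b where "b \<in> C" "v = single b 1" by blast
      then show "u v = 0" using sum_scale[of b u] zero by simp
    qed
  qed (fact M scale span)+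
  also have "card B = card C"
    unfolding B_def
    by (rule card_image, rule inj_onI) (metis \<phi>_B lookup_single_eq lookup_single_not_eq zero_neq_one)
  finally show ?thesis by (simp add: C_def)
qed

section \<open>Quotients of monomial ideals\<close>

lemma submodule_ideal_module:
  assumes "cring R" "ideal I R" "ideal J R" "J \<subseteq> I"
  shows "submodule J R (ideal_module R I)"
proof -
  interpret R: cring R by fact
  interpret J: ideal J R by fact
  interpret M: module R "ideal_module R I" by (rule module_ideal_module) fact+
  show ?thesis
  proof (rule M.submoduleI)
    fix x assume x: "x \<in> J"
    have "\<ominus>\<^bsub>ideal_module R I\<^esub> x = \<ominus>\<^bsub>R\<^esub> x"
      by (rule M.minus_equality)
         (use x assms(4) in \<open>auto simp: ideal_module_def R.l_neg J.Icarr\<close>)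
    then show "\<ominus>\<^bsub>ideal_module R I\<^esub> x \<in> J" using x by simp
  qed (use assms(4) J.I_l_closed in \<open>auto simp: ideal_module_def\<close>)
qed

lemma min_gens_mono_ideal:
  fixes K :: "'k::field itself" and E :: "('v \<Rightarrow>\<^sub>0 nat) set"
  assumes E: "up_closed V E" and fin: "finite (min_exps E)"
  shows "min_gens (poly_ring K V) (ideal_module (poly_ring K V) (mono_ideal E)) = card (min_exps E)"
proof -
  have "min_gens (poly_ring K V) (ideal_module (poly_ring K V) (mono_ideal E)) = card (min_exps E - {})"
  proof (rule min_gens_image_mono_ideal[where \<pi> = "\<lambda>f. f"])
    show "module (poly_ring K V) (ideal_module (poly_ring K V) (mono_ideal E))"
      by (intro module_ideal_module cring_poly_ring ideal_mono_ideal E)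
    show "up_closed V {}" by (simp add: up_closed_def)
    fix f g :: "('v, 'k) mpoly"
    show "f = g \<longleftrightarrow> f - g \<in> mono_ideal {}"
      by (simp add: mono_ideal_def)
  qed (use E fin in \<open>simp_all add: ideal_module_def\<close>)
  then show ?thesis by simp
qed

lemma min_gens_quot_mono_ideal:
  fixes K :: "'k::field itself" and E D :: "('v \<Rightarrow>\<^sub>0 nat) set"
  assumes E: "up_closed V E" and D: "up_closed V D" and DE: "D \<subseteq> E"
    and fin: "finite (min_exps E - D)"
  shows "min_gens (poly_ring K V)
           (quot_module (ideal_module (poly_ring K V) (mono_ideal E)) (mono_ideal D)) =
         card (min_exps E - D)"
proof -
  define R where "R = poly_ring K V"
  define M where "M = ideal_module R (mono_ideal E)"
  define N :: "('v, 'k) mpoly set" where "N = mono_ideal D"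
  have mod: "module R M"
    unfolding M_def R_def by (intro module_ideal_module cring_poly_ring ideal_mono_ideal E)
  have sub: "submodule N R M"
    unfolding M_def R_def N_def using DE
    by (intro submodule_ideal_module cring_poly_ring ideal_mono_ideal E D) (auto simp: mono_ideal_def)
  interpret M: module R M by (rule mod)
  interpret N: submodule N R M by (rule sub)
  interpret NS: abelian_subgroup N M
    by (rule abelian_subgroupI3)
       (simp_all add: additive_subgroup_def N.subgroup_axioms M.abelian_group_axioms)
  have carrier_M: "carrier M = mono_ideal E" and add_M: "add M = (+)" and smult_M: "smult M = (*)"
    by (simp_all add: M_def ideal_module_def R_def)
  have "min_gens R (quot_module M N) = card (min_exps E - D)"
    unfolding R_def
  proof (rule min_gens_image_mono_ideal[where \<pi> = "\<lambda>f. N +>\<^bsub>M\<^esub> f"], fold R_def)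
    show "module R (quot_module M N)" by (rule module_quot_module[OF mod sub])
    show "(\<lambda>f. N +>\<^bsub>M\<^esub> f) ` mono_ideal E = carrier (quot_module M N)"
      by (auto simp: quot_module_def A_RCOSETS_def' carrier_M)
    fix f g :: "('v, 'k) mpoly"
    assume f: "f \<in> mono_ideal E" and g: "g \<in> mono_ideal E"
    show "N +>\<^bsub>M\<^esub> (f + g) = (N +>\<^bsub>M\<^esub> f) \<oplus>\<^bsub>quot_module M N\<^esub> (N +>\<^bsub>M\<^esub> g)"
      using NS.a_rcos_sum[of f g] f g by (simp add: quot_module_def carrier_M add_M)
    show "N +>\<^bsub>M\<^esub> f = N +>\<^bsub>M\<^esub> g \<longleftrightarrow> f - g \<in> mono_ideal D"
    proof
      assume "N +>\<^bsub>M\<^esub> f = N +>\<^bsub>M\<^esub> g"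
      then have "f \<in> N +>\<^bsub>M\<^esub> g" using NS.a_rcos_self[of f] f by (simp add: carrier_M)
      then show "f - g \<in> mono_ideal D" by (auto simp: a_r_coset_def' add_M N_def)
    next
      assume "f - g \<in> mono_ideal D"
      then have "f \<in> N +>\<^bsub>M\<^esub> g" by (auto simp: a_r_coset_def' add_M N_def intro!: bexI[of _ "f - g"])
      then show "N +>\<^bsub>M\<^esub> f = N +>\<^bsub>M\<^esub> g"
        using M.a_repr_independence[of f N g] g NS.a_subgroup by (simp add: carrier_M)
    qed
  next
    fix r f :: "('v, 'k) mpoly" assume "r \<in> carrier R" "f \<in> mono_ideal E"
    then show "N +>\<^bsub>M\<^esub> (r * f) = r \<odot>\<^bsub>quot_module M N\<^esub> (N +>\<^bsub>M\<^esub> f)"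
      using quot_module_smult[OF mod sub, of r f] by (simp add: carrier_M smult_M)
  qed (use E D fin in simp_all)
  then show ?thesis by (simp add: M_def N_def R_def)
qed

section \<open>Exponent vectors of covers\<close>

definition cover_exps :: "'v ugraph \<Rightarrow> nat \<Rightarrow> ('v \<Rightarrow>\<^sub>0 nat) set" where
  "cover_exps G k = {a \<in> mons (verts G). \<forall>e\<in>edges G. k \<le> (\<Sum>v\<in>e. lookup a v)}"

definition edge_exps :: "'v set \<Rightarrow> 'v set \<Rightarrow> nat \<Rightarrow> ('v \<Rightarrow>\<^sub>0 nat) set" where
  "edge_exps V e k = {a \<in> mons V. k \<le> (\<Sum>v\<in>e. lookup a v)}"

lemma up_closed_edge_exps: "up_closed V (edge_exps V e k)"
  by (auto simp: up_closed_def edge_exps_def add_in_mons_iff lookup_add sum.distrib intro: trans_le_add1)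

lemma up_closed_cover_exps: "up_closed (verts G) (cover_exps G k)"
  by (auto simp: up_closed_def cover_exps_def add_in_mons_iff lookup_add sum.distrib
      intro: trans_le_add1)

text \<open>
  The square of the prime \<open>(u, v)\<close> is spanned by the monomials of degree at least 2 in
  \<open>u\<close> and \<open>v\<close>: one variable that occurs can be split off.
\<close>

lemma sumset_edge_exps:
  assumes "finite e" "e \<subseteq> V"
  shows "sumset (edge_exps V e 1) (edge_exps V e 1) = edge_exps V e 2"
proof
  show "sumset (edge_exps V e 1) (edge_exps V e 1) \<subseteq> edge_exps V e 2"
    by (auto simp: sumset_def edge_exps_def add_in_mons_iff lookup_add sum.distrib)
  show "edge_exps V e 2 \<subseteq> sumset (edge_exps V e 1) (edge_exps V e 1)"
  proof
    fix a assume a: "a \<in> edge_exps V e 2"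
    then have "(\<Sum>v\<in>e. lookup a v) \<noteq> 0" by (auto simp: edge_exps_def)
    then obtain v where v: "v \<in> e" "lookup a v \<noteq> 0" by (rule sum.not_neutral_contains_not_neutral)
    define b where "b = a - single v 1"
    have ab: "a = b + single v 1"
      using v(2) by (intro poly_mapping_eqI)
        (auto simp: b_def lookup_add lookup_minus lookup_single when_def)
    have v_sum: "(\<Sum>u\<in>e. lookup (single v (1::nat)) u) = 1"
      using v(1) assms(1) by (simp add: lookup_single when_def)
    have "b \<in> edge_exps V e 1" "single v 1 \<in> edge_exps V e 1"
      using a v_sum unfolding ab by (auto simp: edge_exps_def add_in_mons_iff lookup_add sum.distrib)
    then show "a \<in> sumset (edge_exps V e 1) (edge_exps V e 1)"
      unfolding sumset_def using ab by blast
  qed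
qed

lemma edge_prime_eq:
  assumes "finite e" "e \<subseteq> verts G"
  shows "edge_prime K G e = mono_ideal (edge_exps (verts G) e 1)"
proof -
  have "{a \<in> mons (verts G). \<exists>v\<in>e. v \<in> keys a} = edge_exps (verts G) e 1"
    using assms(1) by (auto simp: edge_exps_def in_keys_iff Suc_le_eq sum_pos2 simp flip: neq0_conv)
  then show ?thesis unfolding edge_prime_def genideal_variables[OF assms(2)] by simp
qed

lemma edgeD:
  assumes "simple_graph G" "e \<in> edges G"
  shows "finite e" "e \<subseteq> verts G"
  using assms finite_subset by (auto simp: simple_graph_def)

lemma cover_ideal_eq:
  assumes "simple_graph G"
  shows "cover_ideal K G = mono_ideal (cover_exps G 1)"
proof -
  have "(\<Inter>e\<in>edges G. edge_prime K G e) = (\<Inter>e\<in>edges G. mono_ideal (edge_exps (verts G) e 1))"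
    by (intro INF_cong refl edge_prime_eq edgeD[OF assms])
  then show ?thesis
    unfolding cover_ideal_def carrier_poly_ring
    by (auto simp: mono_ideal_def cover_exps_def edge_exps_def)
qed

lemma cover_ideal_square_eq:
  assumes "simple_graph G"
  shows "cover_ideal_power K G 2 = mono_ideal (sumset (cover_exps G 1) (cover_exps G 1))"
  unfolding cover_ideal_power_def cover_ideal_eq[OF assms]
  by (rule mono_ideal_square[OF up_closed_cover_exps])

lemma cover_ideal_symbolic_square_eq:
  assumes "simple_graph G"
  shows "cover_ideal_symbolic_power K G 2 = mono_ideal (cover_exps G 2)"
proof -
  have "edge_prime K G e [^]\<^bsub>ideals_set (poly_ring K (verts G))\<^esub> (2::nat) =
      mono_ideal (edge_exps (verts G) e 2)" if "e \<in> edges G" for e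
    unfolding edge_prime_eq[OF edgeD[OF assms that]] mono_ideal_square[OF up_closed_edge_exps]
    unfolding sumset_edge_exps[OF edgeD[OF assms that]] by (rule refl)
  then show ?thesis
    unfolding cover_ideal_symbolic_power_def carrier_poly_ring
    by (auto simp: mono_ideal_def cover_exps_def edge_exps_def)
qed

lemma sumset_covers: "sumset (cover_exps G 1) (cover_exps G 1) \<subseteq> cover_exps G 2"
proof
  fix a assume "a \<in> sumset (cover_exps G 1) (cover_exps G 1)"
  then obtain b c where bc: "b \<in> cover_exps G 1" "c \<in> cover_exps G 1" "a = b + c"
    by (auto simp: sumset_def)
  have "2 \<le> (\<Sum>v\<in>e. lookup a v)" if "e \<in> edges G" for e
  proof -
    have "1 \<le> (\<Sum>v\<in>e. lookup b v)" "1 \<le> (\<Sum>v\<in>e. lookup c v)"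
      using bc that by (auto simp: cover_exps_def)
    then show ?thesis by (simp add: bc lookup_add sum.distrib)
  qed
  then show "a \<in> cover_exps G 2" using bc by (simp add: cover_exps_def add_in_mons_iff)
qed

lemma sdefect_eq_card:
  assumes "simple_graph G"
    and "finite (min_exps (cover_exps G 2) - sumset (cover_exps G 1) (cover_exps G 1))"
  shows "cover_ideal_sdefect K G 2 =
           card (min_exps (cover_exps G 2) - sumset (cover_exps G 1) (cover_exps G 1))"
  unfolding cover_ideal_sdefect_def Let_def
    cover_ideal_square_eq[OF assms(1)] cover_ideal_symbolic_square_eq[OF assms(1)]
  by (intro min_gens_quot_mono_ideal up_closed_cover_exps up_closed_sumset sumset_covers assms(2))

lemma min_gens_cover_ideal_square:
  assumes "simple_graph G" "sumset (cover_exps G 1) (cover_exps G 1) = cover_exps G 2"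
    and "finite (min_exps (cover_exps G 2))"
  shows "min_gens (poly_ring K (verts G)) (ideal_module (poly_ring K (verts G)) (cover_ideal_power K G 2)) =
           card (min_exps (cover_exps G 2))"
  unfolding cover_ideal_square_eq[OF assms(1)] assms(2)
  by (rule min_gens_mono_ideal[OF up_closed_cover_exps assms(3)])

text \<open>
  Rounding half of \<open>a\<close>: both summands vanish where \<open>a\<close> is 0 and are positive where
  \<open>a\<close> is at least 2, and a value 1 goes to the first or the second summand according to
  the colour \<open>c\<close>. So both summands cover every edge with an end of value at least 2. Any
  other edge has the value 1 at both ends, and since their colours differ, each summand
  takes one of them.
\<close>

lemma cover_decomposition:
  fixes c :: "'v \<Rightarrow> bool"
  assumes "simple_graph G" and a: "a \<in> cover_exps G 2"
    and colour: "\<And>u v. {u, v} \<in> edges G \<Longrightarrow> u \<noteq> v \<Longrightarrow> lookup a u = 1 \<Longrightarrow> lookup a v = 1 \<Longrightarrow> c u \<noteq> c v"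
  shows "a \<in> sumset (cover_exps G 1) (cover_exps G 1)"
proof -
  define h :: "'v \<Rightarrow> nat" where "h v = (if lookup a v = 1 then of_bool (c v) else of_bool (lookup a v \<noteq> 0))" for v
  define b :: "'v \<Rightarrow>\<^sub>0 nat" where "b = Poly_Mapping.mapp (\<lambda>v _. h v) a"
  have b: "lookup b v = h v" for v by (auto simp: b_def h_def lookup_mapp in_keys_iff when_def)
  have ab: "a = b + (a - b)"
    by (rule poly_mapping_eqI) (auto simp: lookup_add lookup_minus b h_def)
  have "a \<in> mons (verts G)" using a by (simp add: cover_exps_def)
  then have mons: "b \<in> mons (verts G)" "a - b \<in> mons (verts G)" using ab add_in_mons_iff by metis+
  have "1 \<le> (\<Sum>v\<in>e. lookup b v) \<and> 1 \<le> (\<Sum>v\<in>e. lookup (a - b) v)" if e: "e \<in> edges G" for e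
  proof -
    obtain u v where uv: "e = {u, v}" "u \<noteq> v"
      using assms(1) e by (auto simp: simple_graph_def card_2_iff)
    have "2 \<le> lookup a u + lookup a v" using a e uv by (auto simp: cover_exps_def)
    then show ?thesis using colour[of u v] e uv by (auto simp: lookup_minus b h_def)
  qed
  then have "b \<in> cover_exps G 1" "a - b \<in> cover_exps G 1" using mons by (auto simp: cover_exps_def)
  then show ?thesis unfolding sumset_def using ab by blast
qed

text \<open>
  If some vertex of positive value lies on no edge of total value 2, its value can be lowered
  by one. Conversely, lowering the value of a vertex breaks the condition on a tight edge
  through it.
\<close>

lemma min_cover_iff:
  assumes G: "simple_graph G" and a: "a \<in> cover_exps G 2"
  shows "a \<in> min_exps (cover_exps G 2) \<longleftrightarrow>
           (\<forall>v. lookup a v \<noteq> 0 \<longrightarrow> (\<exists>u. u \<noteq> v \<and> {u, v} \<in> edges G \<and> lookup a u + lookup a v = 2))"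
    (is "_ \<longleftrightarrow> ?tight")
proof
  assume min: "a \<in> min_exps (cover_exps G 2)"
  show ?tight
  proof (intro allI impI, rule ccontr)
    fix v assume v: "lookup a v \<noteq> 0"
      and "\<not> (\<exists>u. u \<noteq> v \<and> {u, v} \<in> edges G \<and> lookup a u + lookup a v = 2)"
    then have loose: "u \<noteq> v \<Longrightarrow> {u, v} \<in> edges G \<Longrightarrow> lookup a u + lookup a v \<noteq> 2" for u by blast
    define b where "b = a - single v 1"
    have ab: "a = b + single v 1"
      using v by (intro poly_mapping_eqI)
        (auto simp: b_def lookup_add lookup_minus lookup_single when_def)
    have "a \<in> mons (verts G)" using a by (simp add: cover_exps_def)
    then have "b \<in> mons (verts G)" using ab add_in_mons_iff by metis
    moreover have "2 \<le> (\<Sum>w\<in>e. lookup b w)" if e: "e \<in> edges G" for e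
    proof -
      obtain u w where uw: "e = {u, w}" "u \<noteq> w"
        using G e by (auto simp: simple_graph_def card_2_iff)
      have "2 \<le> lookup a u + lookup a w" using a e uw by (auto simp: cover_exps_def)
      moreover have "lookup a u + lookup a w \<noteq> 2" if "v \<in> e"
      proof -
        have "v = u \<or> v = w" using that uw by simp
        then show ?thesis
          using loose[of w] loose[of u] uw e by (auto simp: insert_commute add.commute)
      qed
      ultimately show ?thesis using uw v by (auto simp: b_def lookup_minus lookup_single when_def)
    qed
    ultimately have "b \<in> cover_exps G 2" by (simp add: cover_exps_def)
    then have "single v (1::nat) = 0" using min ab by (auto simp: min_exps_def)
    then show False by (metis lookup_single_eq lookup_zero zero_neq_one)
  qed
next
  assume tight: ?tight
  show "a \<in> min_exps (cover_exps G 2)"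
    unfolding min_exps_def
  proof (intro CollectI conjI ballI allI impI a)
    fix b c assume b: "b \<in> cover_exps G 2" and abc: "a = b + c"
    show "c = 0"
    proof (rule poly_mapping_eqI, rule ccontr)
      fix v assume "lookup c v \<noteq> lookup 0 v"
      then have cv: "lookup c v \<noteq> 0" by simp
      then obtain u where "u \<noteq> v" "{u, v} \<in> edges G" "lookup a u + lookup a v = 2"
        using tight abc by (auto simp: lookup_add)
      moreover from this have "2 \<le> lookup b u + lookup b v"
        using b by (auto simp: cover_exps_def)
      ultimately show False using cv abc by (simp add: lookup_add)
    qed
  qed
qed

section \<open>Tight sequences\<close>

text \<open>
  The values of a minimal 2-cover along a path of \<open>n\<close> vertices whose first vertex has a
  further neighbour of value \<open>p\<close>: every edge has total value at least 2, and every vertex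
  of positive value lies on an edge of total value exactly 2. For \<open>p = 2\<close> that neighbour
  imposes no condition on the path, because its edge is always covered and is tight only if the
  first value is 0. The zeros from \<open>n\<close> on make each sequence represent one cover.
\<close>

definition tight_seqs :: "nat \<Rightarrow> nat \<Rightarrow> (nat \<Rightarrow> nat) set" where
  "tight_seqs p n = {f. (\<forall>i\<ge>n. f i = 0) \<and>
     (\<forall>i<n. 2 \<le> case_nat p f i + f i \<and>
        (f i = 0 \<or> case_nat p f i + f i = 2 \<or> Suc i < n \<and> f i + f (Suc i) = 2))}"

lemma tight_seqs_tight:
  assumes "f \<in> tight_seqs p n" "i < n" "f i \<noteq> 0"
  shows "case_nat p f i + f i = 2 \<or> Suc i < n \<and> f i + f (Suc i) = 2"
  using assms by (auto simp: tight_seqs_def)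

text \<open>
  The condition depends on the past only through the preceding value. Therefore a sequence can be
  peeled off from the front, its first entry becoming the preceding value.
\<close>

lemma case_nat_in_tight_seqs_iff:
  "case_nat x f \<in> tight_seqs p (Suc n) \<longleftrightarrow>
     f \<in> tight_seqs x n \<and> 2 \<le> p + x \<and> (x = 0 \<or> p + x = 2 \<or> 0 < n \<and> x + f 0 = 2)"
proof -
  have "(\<forall>i\<ge>Suc n. case_nat x f i = 0) \<longleftrightarrow> (\<forall>i\<ge>n. f i = 0)"
    by (auto split: nat.split dest: Suc_le_D)
  then show ?thesis
    unfolding tight_seqs_def mem_Collect_eq All_less_Suc2 by auto
qed

lemma case_nat_eta: "case_nat (f 0) (\<lambda>i. f (Suc i)) = f"
  by (auto split: nat.split)

lemma finite_tight_seqs: "finite (tight_seqs p n)"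
proof (induction n arbitrary: p)
  case 0
  have "tight_seqs p 0 \<subseteq> {\<lambda>_. 0}" by (auto simp: tight_seqs_def)
  then show ?case by (rule finite_subset) simp
next
  case (Suc n)
  have "f \<in> (\<Union>x\<in>{..2}. case_nat x ` tight_seqs x n)" if f: "f \<in> tight_seqs p (Suc n)" for f
  proof -
    let ?g = "\<lambda>i. f (Suc i)"
    have "case_nat (f 0) ?g \<in> tight_seqs p (Suc n)" using f by (simp only: case_nat_eta)
    then have "?g \<in> tight_seqs (f 0) n" "f 0 \<le> 2" unfolding case_nat_in_tight_seqs_iff by auto
    then have "f \<in> case_nat (f 0) ` tight_seqs (f 0) n"
      by (intro image_eqI[of _ _ ?g]) (simp_all only: case_nat_eta)
    then show ?thesis using \<open>f 0 \<le> 2\<close> by blast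
  qed
  then have "tight_seqs p (Suc n) \<subseteq> (\<Union>x\<in>{..2}. case_nat x ` tight_seqs x n)" by blast
  then show ?case by (rule finite_subset) (simp add: Suc)
qed

lemma inj_case_nat: "case_nat x f = case_nat y g \<longleftrightarrow> x = y \<and> f = g"
proof
  assume eq: "case_nat x f = case_nat y g"
  have "f i = g i" for i using fun_cong[OF eq, of "Suc i"] by simp
  then show "x = y \<and> f = g" using fun_cong[OF eq, of 0] by auto
qed simp

text \<open>
  After the value 1 the first entry is positive. If it is 1, it is tight already. Otherwise
  it must be tight with its successor, which forces \<open>2, 0\<close>; the 0 then forces a 2, which is
  tight and satisfies the edge to its successor on its own.
\<close>

lemma tight_seqs_1_split:
  "tight_seqs 1 (n + 3) =
     case_nat 1 ` tight_seqs 1 (n + 2) \<union>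
     (\<lambda>f. case_nat 2 (case_nat 0 (case_nat 2 f))) ` tight_seqs 2 n"
proof (intro equalityI subsetI)
  fix f assume f: "f \<in> tight_seqs 1 (n + 3)"
  define g where "g i = f (Suc i)" for i
  have fg: "f = case_nat (f 0) g" unfolding g_def by (rule case_nat_eta[symmetric])
  have "f \<in> tight_seqs 1 (Suc (n + 2))" using f by (simp add: numeral_3_eq_3)
  then have "case_nat (f 0) g \<in> tight_seqs 1 (Suc (n + 2))" by (simp only: flip: fg)
  then have g: "g \<in> tight_seqs (f 0) (n + 2)" "1 \<le> f 0" "f 0 = 1 \<or> f 0 + g 0 = 2"
    unfolding case_nat_in_tight_seqs_iff by auto
  show "f \<in> case_nat 1 ` tight_seqs 1 (n + 2) \<union>
     (\<lambda>f. case_nat 2 (case_nat 0 (case_nat 2 f))) ` tight_seqs 2 n"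
  proof (cases "f 0 = 1")
    case True
    then have "f = case_nat 1 g" using fg by metis
    moreover have "g \<in> tight_seqs 1 (n + 2)" using g(1) True by simp
    ultimately show ?thesis by blast
  next
    case False
    define h k where "h i = g (Suc i)" and "k i = g (Suc (Suc i))" for i
    have gh: "g = case_nat (g 0) h" unfolding h_def by (rule case_nat_eta[symmetric])
    have hk: "h = case_nat (h 0) k" unfolding h_def k_def by (rule case_nat_eta[symmetric])
    have 0: "f 0 = 2" "g 0 = 0" using g False by auto
    have "g \<in> tight_seqs 2 (Suc (Suc n))" using g(1) 0 by simp
    then have "case_nat (g 0) h \<in> tight_seqs 2 (Suc (Suc n))" by (simp only: flip: gh)
    then have "h \<in> tight_seqs 0 (Suc n)" unfolding case_nat_in_tight_seqs_iff by (simp add: 0)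
    then have "case_nat (h 0) k \<in> tight_seqs 0 (Suc n)" by (simp only: flip: hk)
    then have "h 0 = 2" "k \<in> tight_seqs (h 0) n" unfolding case_nat_in_tight_seqs_iff by auto
    then have k: "h 0 = 2" "k \<in> tight_seqs 2 n" by simp_all
    then have "f = case_nat 2 (case_nat 0 (case_nat 2 k))" using fg gh hk 0 k(1) by metis
    then show ?thesis using k(2) by blast
  qed
next
  fix f assume "f \<in> case_nat 1 ` tight_seqs 1 (n + 2) \<union>
     (\<lambda>f. case_nat 2 (case_nat 0 (case_nat 2 f))) ` tight_seqs 2 n"
  then show "f \<in> tight_seqs 1 (n + 3)"
    by (auto simp: case_nat_in_tight_seqs_iff numeral_3_eq_3)
qed

lemma card_tight_seqs_1:
  "card (tight_seqs 1 (n + 3)) = card (tight_seqs 1 (n + 2)) + card (tight_seqs 2 n)"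
  unfolding tight_seqs_1_split
  by (subst card_Un_disjoint)
     (auto simp: finite_tight_seqs inj_case_nat card_image inj_on_def)

section \<open>Paths\<close>

lemma edge_path_graph_iff:
  "{u, v} \<in> edges (path_graph l) \<longleftrightarrow> v = Suc u \<and> u < l \<or> u = Suc v \<and> v < l"
  by (auto simp: path_graph_def doubleton_eq_iff)

lemma path_cover_iff:
  "a \<in> cover_exps (path_graph l) 2 \<longleftrightarrow>
     (\<forall>i\<ge>Suc l. lookup a i = 0) \<and> (\<forall>j<l. 2 \<le> lookup a j + lookup a (Suc j))"
proof -
  have "a \<in> mons (verts (path_graph l)) \<longleftrightarrow> (\<forall>i\<ge>Suc l. lookup a i = 0)"
    by (auto simp: mons_def path_graph_def in_keys_iff not_less_eq_eq subset_iff)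
  moreover have "edges (path_graph l) = (\<lambda>j. {j, Suc j}) ` {..<l}" by (auto simp: path_graph_def)
  ultimately show ?thesis by (auto simp: cover_exps_def)
qed

lemma sumset_covers_path:
  "sumset (cover_exps (path_graph l) 1) (cover_exps (path_graph l) 1) = cover_exps (path_graph l) 2"
proof
  show "cover_exps (path_graph l) 2 \<subseteq> sumset (cover_exps (path_graph l) 1) (cover_exps (path_graph l) 1)"
  proof
    fix a assume "a \<in> cover_exps (path_graph l) 2"
    then show "a \<in> sumset (cover_exps (path_graph l) 1) (cover_exps (path_graph l) 1)"
      by (rule cover_decomposition[OF simple_graph_path_graph, where c = even])
         (auto simp: edge_path_graph_iff)
  qed
qed (rule sumset_covers)

lemma min_covers_path_iff:
  "a \<in> min_exps (cover_exps (path_graph l) 2) \<longleftrightarrow> lookup a \<in> tight_seqs 2 (Suc l)"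
proof (cases "a \<in> cover_exps (path_graph l) 2")
  case False
  then show ?thesis
    unfolding path_cover_iff tight_seqs_def All_less_Suc2 by (auto simp: min_exps_def path_cover_iff)
next
  case True
  then have supp: "\<forall>i\<ge>Suc l. lookup a i = 0" and cover: "\<forall>j<l. 2 \<le> lookup a j + lookup a (Suc j)"
    unfolding path_cover_iff by auto
  have nbr: "(\<exists>u. u \<noteq> v \<and> {u, v} \<in> edges (path_graph l) \<and> lookup a u + lookup a v = 2) \<longleftrightarrow>
      (\<exists>u. v = Suc u \<and> lookup a u + lookup a v = 2) \<or> v < l \<and> lookup a v + lookup a (Suc v) = 2"
    (is "?L \<longleftrightarrow> ?R") if "v < Suc l" for v
  proof
    show "?R \<Longrightarrow> ?L"
    proof (elim disjE exE conjE)
      fix u assume "v = Suc u" "lookup a u + lookup a v = 2"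
      then show ?L using that by (intro exI[of _ u]) (simp add: edge_path_graph_iff)
    next
      assume "v < l" "lookup a v + lookup a (Suc v) = 2"
      then show ?L by (intro exI[of _ "Suc v"]) (simp add: edge_path_graph_iff)
    qed
  qed (auto simp: edge_path_graph_iff add.commute)
  have "a \<in> min_exps (cover_exps (path_graph l) 2) \<longleftrightarrow>
      (\<forall>v<Suc l. lookup a v \<noteq> 0 \<longrightarrow>
        (\<exists>u. u \<noteq> v \<and> {u, v} \<in> edges (path_graph l) \<and> lookup a u + lookup a v = 2))"
    unfolding min_cover_iff[OF simple_graph_path_graph True] using supp by (meson not_less)
  also have "\<dots> \<longleftrightarrow> (\<forall>v<Suc l. lookup a v \<noteq> 0 \<longrightarrow>
        (\<exists>u. v = Suc u \<and> lookup a u + lookup a v = 2) \<or> v < l \<and> lookup a v + lookup a (Suc v) = 2)"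
    using nbr by simp
  also have "\<dots> \<longleftrightarrow> lookup a \<in> tight_seqs 2 (Suc l)"
    unfolding tight_seqs_def All_less_Suc2 using supp cover by auto
  finally show ?thesis .
qed

text \<open>
  Sequences indexed from 0 are literally the exponent vectors on \<open>path_graph l\<close>, whose
  \<open>l + 1\<close> vertices explain the successor.
\<close>

lemma bij_betw_min_covers_path:
  "bij_betw lookup (min_exps (cover_exps (path_graph l) 2)) (tight_seqs 2 (Suc l))"
proof (rule bij_betw_imageI)
  show "inj_on lookup (min_exps (cover_exps (path_graph l) 2))"
    by (rule inj_onI, rule poly_mapping_eqI) simp
  have "f \<in> lookup ` min_exps (cover_exps (path_graph l) 2)" if f: "f \<in> tight_seqs 2 (Suc l)" for f
  proof -
    have "i \<le> l" if "f i \<noteq> 0" for i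
    proof -
      have "\<not> Suc l \<le> i" using f that by (auto simp: tight_seqs_def)
      then show ?thesis by simp
    qed
    then have "{i. f i \<noteq> 0} \<subseteq> {..l}" by blast
    then have "finite {i. f i \<noteq> 0}" by (rule finite_subset) simp
    then have "f = lookup (Abs_poly_mapping f)" by simp
    then show ?thesis using f min_covers_path_iff by (metis imageI)
  qed
  then show "lookup ` min_exps (cover_exps (path_graph l) 2) = tight_seqs 2 (Suc l)"
    by (auto simp: min_covers_path_iff)
qed

section \<open>The triangle with a tail\<close>

text \<open>
  The tail is renumbered from 0, and \<open>X3\<close> is the vertex in front of it, so that the edges of
  the tail and the edge that attaches it to the triangle have one common form.
\<close>

definition tail_prev :: "nat \<Rightarrow> tvertex" where
  "tail_prev i = case_nat X3 (\<lambda>j. Y (Suc j)) i"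

definition tail :: "(tvertex \<Rightarrow>\<^sub>0 nat) \<Rightarrow> nat \<Rightarrow> nat" where
  "tail a i = lookup a (Y (Suc i))"

lemma lookup_tail_prev: "lookup a (tail_prev i) = case_nat (lookup a X3) (tail a) i"
  by (simp add: tail_prev_def tail_def split: nat.split)

lemma edges_T_graph:
  assumes "n \<ge> 1"
  shows "edges (T_graph n) = {{X1, X2}, {X2, X3}, {X1, X3}} \<union> (\<lambda>i. {tail_prev i, Y (Suc i)}) ` {..<n}"
proof -
  obtain k where n: "n = Suc k" using assms by (cases n) auto
  have "{{Y i, Y (i + 1)} | i. 1 \<le> i \<and> i + 1 \<le> n} = (\<lambda>i. {Y (Suc i), Y (Suc (Suc i))}) ` {..<k}"
    unfolding n by (auto simp: image_iff) (metis Suc_le_D Suc_le_lessD lessThan_iff less_eq_Suc_le)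
  then show ?thesis
    unfolding n lessThan_Suc_eq_insert_0 image_insert image_image
    by (auto simp: T_graph_def tail_prev_def)
qed

lemma T_cover_iff:
  assumes "n \<ge> 1"
  shows "a \<in> cover_exps (T_graph n) k \<longleftrightarrow>
     a \<in> mons (verts (T_graph n)) \<and>
     k \<le> lookup a X1 + lookup a X2 \<and> k \<le> lookup a X2 + lookup a X3 \<and> k \<le> lookup a X1 + lookup a X3 \<and>
     (\<forall>i<n. k \<le> case_nat (lookup a X3) (tail a) i + tail a i)"
proof -
  have ne: "tail_prev i \<noteq> Y (Suc i)" for i by (simp add: tail_prev_def split: nat.split)
  show ?thesis
    unfolding cover_exps_def edges_T_graph[OF assms]
    by (auto simp: ne lookup_tail_prev simp flip: tail_def)
qed

text \<open>
  If some triangle vertex has a value different from 1, then at most one triangle edge joins two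
  vertices of value 1. The colouring \<open>c\<close> separates its ends and alternates along the tail,
  starting from \<open>X3\<close>: the edge \<open>{X2, X3}\<close> is always separated, and the colour of
  \<open>X1\<close> agrees with that of \<open>X2\<close> or of \<open>X3\<close> depending on the value at \<open>X3\<close>.
\<close>

lemma ones_if_indecomposable:
  assumes n: "n \<ge> 1" and a: "a \<in> cover_exps (T_graph n) 2"
    and "a \<notin> sumset (cover_exps (T_graph n) 1) (cover_exps (T_graph n) 1)"
  shows "lookup a X1 = 1" "lookup a X2 = 1" "lookup a X3 = 1"
proof -
  define c where "c v = (case v of X1 \<Rightarrow> lookup a X3 \<noteq> 1 | X2 \<Rightarrow> False | X3 \<Rightarrow> True | Y i \<Rightarrow> even i)" for v
  have tail_prev: "c (tail_prev i) \<noteq> c (Y (Suc i))" for i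
    by (simp add: c_def tail_prev_def split: nat.split)
  have "lookup a X1 = 1 \<and> lookup a X2 = 1 \<and> lookup a X3 = 1"
  proof (rule ccontr)
    assume not_ones: "\<not> ?thesis"
    have "a \<in> sumset (cover_exps (T_graph n) 1) (cover_exps (T_graph n) 1)"
    proof (rule cover_decomposition[OF simple_graph_T_graph[OF n] a, where c = c])
      fix u v
      assume "{u, v} \<in> edges (T_graph n)" "lookup a u = 1" "lookup a v = 1"
      then show "c u \<noteq> c v"
        using not_ones tail_prev unfolding edges_T_graph[OF n]
        by (auto simp: doubleton_eq_iff c_def)
    qed
    then show False using assms(3) by contradiction
  qed
  then show "lookup a X1 = 1" "lookup a X2 = 1" "lookup a X3 = 1" by auto
qed

text \<open>
  Every 1-cover has a total value of at least 2 on the triangle, so a sum of two has at least 4,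
  whereas three ones only make 3.
\<close>

lemma indecomposable_if_ones:
  assumes n: "n \<ge> 1" and ones: "lookup a X1 = 1" "lookup a X2 = 1" "lookup a X3 = 1"
  shows "a \<notin> sumset (cover_exps (T_graph n) 1) (cover_exps (T_graph n) 1)"
proof
  assume "a \<in> sumset (cover_exps (T_graph n) 1) (cover_exps (T_graph n) 1)"
  then obtain b c where bc: "b \<in> cover_exps (T_graph n) 1" "c \<in> cover_exps (T_graph n) 1" "a = b + c"
    by (auto simp: sumset_def)
  have triangle: "2 \<le> lookup d X1 + lookup d X2 + lookup d X3" if "d \<in> cover_exps (T_graph n) 1" for d
  proof -
    have "1 \<le> lookup d X1 + lookup d X2" "1 \<le> lookup d X2 + lookup d X3" "1 \<le> lookup d X1 + lookup d X3"
      using that unfolding T_cover_iff[OF n] by auto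
    then show ?thesis by presburger
  qed
  show False using triangle[OF bc(1)] triangle[OF bc(2)] ones by (simp add: bc(3) lookup_add)
qed

text \<open>
  The triangle vertices of value 1 are tight with each other, hence minimality only concerns the
  tail, and there it is tightness of the sequence that follows the value 1 at \<open>X3\<close>.
\<close>

lemma indecomposable_min_covers_T_iff:
  assumes n: "n \<ge> 1"
  shows "a \<in> min_exps (cover_exps (T_graph n) 2) - sumset (cover_exps (T_graph n) 1) (cover_exps (T_graph n) 1)
     \<longleftrightarrow> a \<in> mons (verts (T_graph n)) \<and> lookup a X1 = 1 \<and> lookup a X2 = 1 \<and> lookup a X3 = 1 \<and>
         tail a \<in> tight_seqs 1 n" (is "?L \<longleftrightarrow> ?R")
proof -
  have edge: "{u, Y (Suc i)} \<in> edges (T_graph n) \<longleftrightarrow> u = tail_prev i \<or> Suc i < n \<and> u = Y (Suc (Suc i))"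
    if "i < n" for u i
  proof -
    have prev: "Y (Suc i) = tail_prev j \<longleftrightarrow> j = Suc i" for j
      by (auto simp: tail_prev_def split: nat.split)
    have "{u, Y (Suc i)} \<in> edges (T_graph n) \<longleftrightarrow> (\<exists>j<n. {u, Y (Suc i)} = {tail_prev j, Y (Suc j)})"
      unfolding edges_T_graph[OF n] Un_iff image_iff by (simp add: doubleton_eq_iff Bex_def)
    also have "\<dots> \<longleftrightarrow> (\<exists>j<n. u = tail_prev j \<and> i = j \<or> u = Y (Suc j) \<and> j = Suc i)"
      unfolding doubleton_eq_iff prev by simp
    also have "\<dots> \<longleftrightarrow> u = tail_prev i \<or> Suc i < n \<and> u = Y (Suc (Suc i))"
      using that by blast
    finally show ?thesis .
  qed
  have tri: "{X1, X2} \<in> edges (T_graph n)" "{X1, X3} \<in> edges (T_graph n)"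
    by (simp_all add: T_graph_def)
  have supp: "tail a i = 0" if "a \<in> mons (verts (T_graph n))" "i \<ge> n" for i
    using that by (auto simp: tail_def mons_def T_graph_def in_keys_iff)
  have tail_min: "(\<exists>u. u \<noteq> Y (Suc i) \<and> {u, Y (Suc i)} \<in> edges (T_graph n) \<and> lookup a u + lookup a (Y (Suc i)) = 2)
      \<longleftrightarrow> case_nat (lookup a X3) (tail a) i + tail a i = 2 \<or> Suc i < n \<and> tail a i + tail a (Suc i) = 2"
    if "i < n" for i
  proof -
    have "tail_prev i \<noteq> Y (Suc i)" "Y (Suc (Suc i)) \<noteq> Y (Suc i)"
      by (simp_all add: tail_prev_def split: nat.split)
    then show ?thesis
      unfolding edge[OF that] lookup_tail_prev[symmetric] tail_def
        add.commute[of "lookup a (Y (Suc i))" "lookup a (Y (Suc (Suc i)))"]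
      by blast
  qed
  show ?thesis
  proof
    assume L: ?L
    then have cover: "a \<in> cover_exps (T_graph n) 2" by (auto simp: min_exps_def)
    have ones: "lookup a X1 = 1" "lookup a X2 = 1" "lookup a X3 = 1"
      using ones_if_indecomposable[OF n cover] L by auto
    have mons: "a \<in> mons (verts (T_graph n))" using cover by (simp add: cover_exps_def)
    have "tail a i = 0 \<or> case_nat 1 (tail a) i + tail a i = 2 \<or> Suc i < n \<and> tail a i + tail a (Suc i) = 2"
      if "i < n" for i
      using L tail_min[OF that]
      unfolding Diff_iff min_cover_iff[OF simple_graph_T_graph[OF n] cover] ones
      by (auto simp: tail_def)
    moreover have "\<forall>i<n. 2 \<le> case_nat 1 (tail a) i + tail a i"
      using cover unfolding T_cover_iff[OF n] ones by blast
    ultimately have "tail a \<in> tight_seqs 1 n"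
      unfolding tight_seqs_def using supp[OF mons] by blast
    then show ?R using ones mons by blast
  next
    assume R: ?R
    then have ones: "lookup a X1 = 1" "lookup a X2 = 1" "lookup a X3 = 1"
      and mons: "a \<in> mons (verts (T_graph n))" and tight: "tail a \<in> tight_seqs 1 n" by blast+
    have cover: "a \<in> cover_exps (T_graph n) 2"
      using R unfolding T_cover_iff[OF n] ones tight_seqs_def by simp
    have "\<exists>u. u \<noteq> v \<and> {u, v} \<in> edges (T_graph n) \<and> lookup a u + lookup a v = 2"
      if v: "lookup a v \<noteq> 0" for v
    proof (cases v)
      case X1
      then show ?thesis using tri ones by (intro exI[of _ X2]) (simp add: insert_commute)
    next
      case X2
      then show ?thesis using tri ones by (intro exI[of _ X1]) simp
    next
      case X3
      then show ?thesis using tri ones by (intro exI[of _ X1]) simp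
    next
      case (Y m)
      then have "Y m \<in> keys a" using v by (simp add: in_keys_iff)
      then have "Y m \<in> verts (T_graph n)" using mons by (auto simp: mons_def)
      then have "m \<in> {1..n}" by (auto simp: T_graph_def)
      then obtain i where i: "m = Suc i" "i < n" by (cases m) auto
      have "tail a i \<noteq> 0" using v Y i by (simp add: tail_def)
      then have "case_nat 1 (tail a) i + tail a i = 2 \<or> Suc i < n \<and> tail a i + tail a (Suc i) = 2"
        by (rule tight_seqs_tight[OF tight i(2)])
      then show ?thesis unfolding Y i(1) tail_min[OF i(2)] ones .
    qed
    then have "a \<in> min_exps (cover_exps (T_graph n) 2)"
      unfolding min_cover_iff[OF simple_graph_T_graph[OF n] cover] by blast
    then show ?L using indecomposable_if_ones[OF n ones] by blast
  qed
qed

lemma bij_betw_indecomposable_min_covers_T: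
  assumes n: "n \<ge> 1"
  shows "bij_betw tail
    (min_exps (cover_exps (T_graph n) 2) - sumset (cover_exps (T_graph n) 1) (cover_exps (T_graph n) 1))
    (tight_seqs 1 n)" (is "bij_betw tail ?C _")
proof (rule bij_betw_imageI)
  have Y0: "lookup a (Y 0) = 0" if "a \<in> ?C" for a
    using that unfolding indecomposable_min_covers_T_iff[OF n]
    by (auto simp: mons_def T_graph_def in_keys_iff)
  show "inj_on tail ?C"
  proof (rule inj_onI, rule poly_mapping_eqI)
    fix a b v assume a: "a \<in> ?C" and b: "b \<in> ?C" and eq: "tail a = tail b"
    have "lookup a (Y (Suc i)) = lookup b (Y (Suc i))" for i
      using fun_cong[OF eq, of i] by (simp add: tail_def)
    then have "lookup a (Y m) = lookup b (Y m)" for m using Y0[OF a] Y0[OF b] by (cases m) auto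
    then show "lookup a v = lookup b v"
      using a b unfolding indecomposable_min_covers_T_iff[OF n] by (cases v) auto
  qed
  have "f \<in> tail ` ?C" if f: "f \<in> tight_seqs 1 n" for f
  proof -
    \<comment> \<open>The entry at \<open>Y 0\<close> is 0, because \<open>Y 0\<close> is not a vertex.\<close>
    define g where "g v = (case v of Y m \<Rightarrow> case_nat 0 f m | _ \<Rightarrow> 1)" for v
    have supp: "{v. g v \<noteq> 0} \<subseteq> verts (T_graph n)"
    proof
      fix v assume "v \<in> {v. g v \<noteq> 0}"
      then show "v \<in> verts (T_graph n)"
        using f by (cases v) (auto simp: g_def T_graph_def tight_seqs_def image_iff not_less Suc_le_eq
            split: nat.splits intro: leI)
    qed
    then have "finite {v. g v \<noteq> 0}" by (rule finite_subset) (simp add: T_graph_def)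
    then have lookup: "lookup (Abs_poly_mapping g) = g" by simp
    have "tail (Abs_poly_mapping g) = f" by (rule ext) (simp add: tail_def lookup g_def)
    moreover have "Abs_poly_mapping g \<in> ?C"
      unfolding indecomposable_min_covers_T_iff[OF n] calculation
      using f supp by (auto simp: lookup mons_def in_keys_iff g_def)
    ultimately show ?thesis by blast
  qed
  moreover have "tail a \<in> tight_seqs 1 n" if "a \<in> ?C" for a
    using that unfolding indecomposable_min_covers_T_iff[OF n] by blast
  ultimately show "tail ` ?C = tight_seqs 1 n" by blast
qed

lemma sdefect_T_graph:
  assumes "n \<ge> 1"
  shows "cover_ideal_sdefect K (T_graph n) 2 = card (tight_seqs 1 n)"
proof -
  have fin: "finite (min_exps (cover_exps (T_graph n) 2) -
      sumset (cover_exps (T_graph n) 1) (cover_exps (T_graph n) 1))"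
    using bij_betw_finite[OF bij_betw_indecomposable_min_covers_T[OF assms]] finite_tight_seqs
    by blast
  show ?thesis
    using sdefect_eq_card[OF simple_graph_T_graph[OF assms] fin]
      bij_betw_same_card[OF bij_betw_indecomposable_min_covers_T[OF assms]]
    by (rule trans)
qed

lemma min_gens_path_square:
  "min_gens (poly_ring K (verts (path_graph l)))
     (ideal_module (poly_ring K (verts (path_graph l))) (cover_ideal_power K (path_graph l) 2)) =
   card (tight_seqs 2 (Suc l))"
proof -
  have fin: "finite (min_exps (cover_exps (path_graph l) 2))"
    using bij_betw_finite[OF bij_betw_min_covers_path] finite_tight_seqs by blast
  show ?thesis
    using min_gens_cover_ideal_square[OF simple_graph_path_graph sumset_covers_path fin]
      bij_betw_same_card[OF bij_betw_min_covers_path]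
    by (rule trans)
qed

theorem theorem4p8:
  fixes n :: nat
  assumes "n \<ge> 5"
  shows "cover_ideal_sdefect TYPE('k::field) (T_graph n) 2 =
           cover_ideal_sdefect TYPE('k) (T_graph (n - 1)) 2 +
           min_gens (poly_ring TYPE('k) (verts (path_graph (n - 4))))
             (ideal_module (poly_ring TYPE('k) (verts (path_graph (n - 4))))
                (cover_ideal_power TYPE('k) (path_graph (n - 4)) 2))"
proof -
  have "n - 3 + 3 = n" "n - 3 + 2 = n - 1" "n - 3 = Suc (n - 4)" using assms by auto
  then have "card (tight_seqs 1 n) = card (tight_seqs 1 (n - 1)) + card (tight_seqs 2 (Suc (n - 4)))"
    using card_tight_seqs_1[of "n - 3"] by simp
  then show ?thesis
    using assms by (simp only: sdefect_T_graph min_gens_path_square)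
qed

end
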